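(* Let $n>2$ and let $\phi=(f_0:f_1:\cdots:f_n):\mathcal X\to\mathbb P^n(\overline{\mathbb F}_q)$ be a nondegenerate morphism defined over $\mathbb F_q$ such that $\mathcal X$ is $(q^u,q^m)$-Frobenius nonclassical with respect to $\phi$. Let $(\kappa_0,\ldots,\kappa_{n-2})$ be the $(q^u,q^m)$-Frobenius order-sequence of $\mathcal X$ with respect to $\phi$, and let $\ell\in\{1,\ldots,n-2\}$ be such that $\kappa_i=i$ for $i<\ell$ and $\kappa_\ell>\ell$. Then $p\mid\kappa_\ell$.
   Context: $\mathbb F_q$ is a finite field of characteristic $p$, $\overline{\mathbb F}_q$ its algebraic closure. $\mathcal X$ is a projective, geometrically irreducible, nonsingular algebraic curve defined over $\mathbb F_q$. Nondegenerate means that the image of $\phi$ is not contained in a hyperplane; the coordinate functions $f_i$ lie in $\mathbb F_q(\mathcal X)$. $u,m$ are coprime integers with $m>u\ge1$. $D_t^{(r)}$ is the $r$-th Hasse derivative with respect to a separating variable $t$. For a separating variable $t\in\mathbb F_q(\mathcal X)$ and non-negative integers $\rho_0,\ldots,\rho_{n-2}$, let $\mathcal A_t^{\rho_0,\ldots,\rho_{n-2}}(f_0,\ldots,f_n)$ be the determinant of the $(n+1)\times(n+1)$ matrix whose rows are $(f_0^{q^m},\ldots,f_n^{q^m})$, $(f_0^{q^u},\ldots,f_n^{q^u})$, and $(D_t^{(\rho_i)}f_0,\ldots,D_t^{(\rho_i)}f_n)$ for $i=0,\ldots,n-2$. The $(q^u,q^m)$-Frobenius order-sequence $(\kappa_0,\ldots,\kappa_{n-2})$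 of $\mathcal X$ with respect to $\phi$ is the lexicographically minimal sequence $0\le\kappa_0<\cdots<\kappa_{n-2}$ with $\mathcal A_t^{\kappa_0,\ldots,\kappa_{n-2}}(f_0,\ldots,f_n)\neq0$ (it does not depend on the choice of $t$). $\mathcal X$ is $(q^u,q^m)$-Frobenius classical with respect to $\phi$ if $\kappa_i=i$ for all $i\in\{0,\ldots,n-2\}$, and $(q^u,q^m)$-Frobenius nonclassical otherwise. *)

theory Defs
  imports
    "HOL-Algebra.Algebraic_Closure_Type"
    "HOL-Library.Cardinality"
    "HOL-Library.Function_Algebras"
    "HOL-Library.Poly_Mapping"
    "Jordan_Normal_Form.Determinant"
begin

section \<open>Forms in the variables \<open>X\<^sub>0, \<dots>, X\<^sub>N\<close>\<close>

type_synonym 'c mpoly = "(nat \<Rightarrow>\<^sub>0 nat) \<Rightarrow>\<^sub>0 'c"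

definition mp_eval :: "(nat \<Rightarrow> 'c) \<Rightarrow> 'c::comm_ring_1 mpoly \<Rightarrow> 'c" where
  "mp_eval x P = (\<Sum>m \<in> Poly_Mapping.keys P.
     Poly_Mapping.lookup P m * (\<Prod>i \<in> Poly_Mapping.keys m. x i ^ Poly_Mapping.lookup m i))"

definition mp_partial :: "nat \<Rightarrow> 'c::comm_ring_1 mpoly \<Rightarrow> 'c mpoly" where
  "mp_partial i P = (\<Sum>m \<in> Poly_Mapping.keys P.
     Poly_Mapping.single (m - Poly_Mapping.single i 1)
       (of_nat (Poly_Mapping.lookup m i) * Poly_Mapping.lookup P m))"

definition forms :: "nat \<Rightarrow> nat \<Rightarrow> 'c::comm_ring_1 mpoly set" where
  "forms N d = {P. \<forall>m \<in> Poly_Mapping.keys P. Poly_Mapping.keys m \<subseteq> {..N} \<and>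
     (\<Sum>i \<in> Poly_Mapping.keys m. Poly_Mapping.lookup m i) = d}"

abbreviation base_change :: "('b::comm_ring_1 \<Rightarrow> 'c::comm_ring_1) \<Rightarrow> 'b mpoly \<Rightarrow> 'c mpoly" where
  "base_change \<equiv> Poly_Mapping.map"


section \<open>Projective algebraic sets\<close>

text \<open>Points of projective \<open>N\<close>-space are given by their homogeneous coordinate vectors, and a
  projective algebraic set is identified with the set of \<^emph>\<open>all\<close> homogeneous coordinate vectors of
  its points (its affine cone without the origin).\<close>

definition pspace :: "nat \<Rightarrow> (nat \<Rightarrow> 'k::field) set" where
  "pspace N = {x. (\<exists>i\<le>N. x i \<noteq> 0) \<and> (\<forall>i>N. x i = 0)}"

definition zariski_closed :: "nat \<Rightarrow> (nat \<Rightarrow> 'k::field) set \<Rightarrow> bool" where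
  "zariski_closed N Z \<longleftrightarrow>
     (\<exists>S \<subseteq> (\<Union>d. forms N d). Z = {x \<in> pspace N. \<forall>P\<in>S. mp_eval x P = 0})"

definition zariski_irreducible :: "nat \<Rightarrow> (nat \<Rightarrow> 'k::field) set \<Rightarrow> bool" where
  "zariski_irreducible N Z \<longleftrightarrow> zariski_closed N Z \<and> Z \<noteq> {} \<and>
     (\<forall>Z1 Z2. zariski_closed N Z1 \<and> zariski_closed N Z2 \<and> Z = Z1 \<union> Z2 \<longrightarrow> Z = Z1 \<or> Z = Z2)"

definition irreducible_chain ::
    "nat \<Rightarrow> (nat \<Rightarrow> 'k::field) set \<Rightarrow> nat \<Rightarrow> (nat \<Rightarrow> (nat \<Rightarrow> 'k) set) \<Rightarrow> bool" where
  "irreducible_chain N C d Z \<longleftrightarrow>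
     (\<forall>i\<le>d. zariski_irreducible N (Z i) \<and> Z i \<subseteq> C) \<and> (\<forall>i<d. Z i \<subset> Z (Suc i))"

definition has_zariski_dim :: "nat \<Rightarrow> (nat \<Rightarrow> 'k::field) set \<Rightarrow> nat \<Rightarrow> bool" where
  "has_zariski_dim N C d \<longleftrightarrow>
     (\<exists>Z. irreducible_chain N C d Z) \<and> \<not> (\<exists>Z. irreducible_chain N C (Suc d) Z)"

definition vanishing_forms :: "nat \<Rightarrow> (nat \<Rightarrow> 'k::field) set \<Rightarrow> 'k mpoly set" where
  "vanishing_forms N C = {P \<in> (\<Union>d. forms N d). \<forall>x\<in>C. mp_eval x P = 0}"

text \<open>The homogeneous ideal of \<open>C\<close> is generated by forms with coefficients in the base field;
  \<open>module.span (*)\<close> is the ideal generated by a set.\<close>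

definition defined_over_base :: "nat \<Rightarrow> (nat \<Rightarrow> 'a::field alg_closure) set \<Rightarrow> bool" where
  "defined_over_base N C \<longleftrightarrow>
     (\<exists>S \<subseteq> (\<Union>d. forms N d) :: 'a mpoly set.
        base_change to_ac ` S \<subseteq> vanishing_forms N C \<and>
        vanishing_forms N C \<subseteq> module.span (*) (base_change to_ac ` S))"

text \<open>Jacobian criterion for a curve in projective \<open>N\<close>-space: the Jacobian matrix has rank
  \<open>N - 1\<close> at every point.\<close>

definition nonsingular_curve :: "nat \<Rightarrow> (nat \<Rightarrow> 'k::field) set \<Rightarrow> bool" where
  "nonsingular_curve N C \<longleftrightarrow> (\<forall>x\<in>C.
     vector_space.dim (\<lambda>c (v :: nat \<Rightarrow> 'k) i. c * v i)
       ((\<lambda>P i. mp_eval x (mp_partial i P)) ` vanishing_forms N C) + 1 = N)"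

text \<open>Geometric irreducibility is irreducibility over the algebraic closure, where the points
  live.\<close>

definition smooth_projective_curve :: "nat \<Rightarrow> (nat \<Rightarrow> 'a::field alg_closure) set \<Rightarrow> bool" where
  "smooth_projective_curve N C \<longleftrightarrow>
     zariski_irreducible N C \<and> has_zariski_dim N C 1 \<and> defined_over_base N C \<and>
     nonsingular_curve N C"


section \<open>Function fields and morphisms\<close>

text \<open>The function field of \<open>C\<close> over the base field \<open>'a\<close> consists of the quotients \<open>G / H\<close> of
  forms of equal degree over \<open>'a\<close>, with \<open>H\<close> not vanishing identically on \<open>C\<close>, where \<open>G / H\<close> and
  \<open>G' / H'\<close> are identified if \<open>G H' - G' H\<close> vanishes on \<open>C\<close>.  The predicate below says that the
  field \<open>'f\<close> (with constants embedded by \<open>\<iota>\<close>) is this function field: sending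
  \<open>G / H\<close> to \<open>G(\<xi>) / H(\<xi>)\<close>, where \<open>\<xi>\<close> are the homogeneous coordinates of a generic point of
  \<open>C\<close>, is well defined and injective (second conjunct) and surjective (third conjunct).\<close>

definition is_function_field ::
    "nat \<Rightarrow> (nat \<Rightarrow> 'a::field alg_closure) set \<Rightarrow> ('a \<Rightarrow> 'f::field) \<Rightarrow> (nat \<Rightarrow> 'f) \<Rightarrow> bool" where
  "is_function_field N C \<iota> \<xi> \<longleftrightarrow> field_hom \<iota> \<and>
     (\<forall>d. \<forall>P \<in> forms N d. mp_eval \<xi> (base_change \<iota> P) = 0 \<longleftrightarrow>
        (\<forall>x\<in>C. mp_eval x (base_change to_ac P) = 0)) \<and>
     (\<forall>g. \<exists>d. \<exists>G \<in> forms N d. \<exists>H \<in> forms N d. mp_eval \<xi> (base_change \<iota> H) \<noteq> 0 \<and>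
        g = mp_eval \<xi> (base_change \<iota> G) / mp_eval \<xi> (base_change \<iota> H))"

text \<open>\<open>\<phi> = (f\<^sub>0 : \<dots> : f\<^sub>n)\<close> is a morphism on \<open>C\<close>: around every point \<open>x\<close> it is given by
  forms \<open>G\<^sub>0, \<dots>, G\<^sub>n\<close> of equal degree, without common zero at \<open>x\<close>, such that \<open>(G\<^sub>0 : \<dots> : G\<^sub>n)\<close> and
  \<open>(f\<^sub>0 : \<dots> : f\<^sub>n)\<close> agree over the function field.  The vector \<open>\<phi> x\<close> is an arbitrary choice of
  homogeneous coordinates of the image point, hence the factor \<open>c\<close>.\<close>

definition is_morphism ::
    "nat \<Rightarrow> (nat \<Rightarrow> 'a::field alg_closure) set \<Rightarrow> ('a \<Rightarrow> 'f::field) \<Rightarrow> (nat \<Rightarrow> 'f) \<Rightarrow>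
     nat \<Rightarrow> (nat \<Rightarrow> 'f) \<Rightarrow> ((nat \<Rightarrow> 'a alg_closure) \<Rightarrow> (nat \<Rightarrow> 'a alg_closure)) \<Rightarrow> bool" where
  "is_morphism N C \<iota> \<xi> n f \<phi> \<longleftrightarrow> (\<exists>i\<le>n. f i \<noteq> 0) \<and>
     (\<forall>x\<in>C. \<phi> x \<in> pspace n \<and>
        (\<exists>d G c. (\<forall>i\<le>n. G i \<in> forms N d) \<and>
           (\<forall>i\<le>n. \<forall>j\<le>n. f i * mp_eval \<xi> (base_change \<iota> (G j)) =
                          f j * mp_eval \<xi> (base_change \<iota> (G i))) \<and>
           c \<noteq> 0 \<and> (\<forall>i\<le>n. \<phi> x i = c * mp_eval x (base_change to_ac (G i)))))"

definition nondegenerate ::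
    "(nat \<Rightarrow> 'k::field) set \<Rightarrow> nat \<Rightarrow> ((nat \<Rightarrow> 'k) \<Rightarrow> (nat \<Rightarrow> 'k)) \<Rightarrow> bool" where
  "nondegenerate C n \<phi> \<longleftrightarrow>
     \<not> (\<exists>a. (\<exists>i\<le>n. a i \<noteq> 0) \<and> (\<forall>x\<in>C. (\<Sum>i\<le>n. a i * \<phi> x i) = 0))"


section \<open>Separating variables and Hasse derivatives\<close>

definition simple_extension :: "('a::field \<Rightarrow> 'f::field) \<Rightarrow> 'f \<Rightarrow> 'f set" where
  "simple_extension \<iota> t =
     {poly (map_poly \<iota> a) t / poly (map_poly \<iota> b) t | a b. poly (map_poly \<iota> b) t \<noteq> 0}"

text \<open>Every element of \<open>'f\<close> is a root of a separable polynomial over the subfield generated by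
  \<open>t\<close>.\<close>

definition separating_variable :: "('a::field \<Rightarrow> 'f::field) \<Rightarrow> 'f \<Rightarrow> bool" where
  "separating_variable \<iota> t \<longleftrightarrow>
     (\<forall>g. \<exists>Q. (\<forall>i. poly.coeff Q i \<in> simple_extension \<iota> t) \<and> poly Q g = 0 \<and> coprime Q (pderiv Q))"

text \<open>\<open>D r g\<close> is the \<open>r\<close>-th Hasse derivative of \<open>g\<close> with respect to \<open>t\<close>: the conditions below
  are the usual ones, and for a separating variable \<open>t\<close> exactly one \<open>D\<close> satisfies them.\<close>

definition hasse_derivatives ::
    "('a::field \<Rightarrow> 'f::field) \<Rightarrow> 'f \<Rightarrow> (nat \<Rightarrow> 'f \<Rightarrow> 'f) \<Rightarrow> bool" where
  "hasse_derivatives \<iota> t D \<longleftrightarrow>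
     (\<forall>g. D 0 g = g) \<and>
     (\<forall>r g h. D r (g + h) = D r g + D r h) \<and>
     (\<forall>r c g. D r (\<iota> c * g) = \<iota> c * D r g) \<and>
     (\<forall>r g h. D r (g * h) = (\<Sum>i\<le>r. D i g * D (r - i) h)) \<and>
     (\<forall>r j. D r (t ^ j) = of_nat (j choose r) * t ^ (j - r))"


section \<open>Frobenius orders\<close>

definition frobenius_det ::
    "nat \<Rightarrow> nat \<Rightarrow> nat \<Rightarrow> nat \<Rightarrow> (nat \<Rightarrow> 'f \<Rightarrow> 'f) \<Rightarrow> (nat \<Rightarrow> 'f::field) \<Rightarrow> nat list \<Rightarrow> 'f" where
  "frobenius_det q u m n D f \<rho> = det (mat (n + 1) (n + 1) (\<lambda>(i, j).
     if i = 0 then f j ^ (q ^ m)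
     else if i = 1 then f j ^ (q ^ u)
     else D (\<rho> ! (i - 2)) (f j)))"

definition frobenius_order_sequence ::
    "nat \<Rightarrow> nat \<Rightarrow> nat \<Rightarrow> nat \<Rightarrow> (nat \<Rightarrow> 'f \<Rightarrow> 'f) \<Rightarrow> (nat \<Rightarrow> 'f::field) \<Rightarrow> nat list \<Rightarrow> bool" where
  "frobenius_order_sequence q u m n D f \<kappa> \<longleftrightarrow>
     length \<kappa> = n - 1 \<and> sorted_wrt (<) \<kappa> \<and> frobenius_det q u m n D f \<kappa> \<noteq> 0 \<and>
     (\<forall>\<rho>. length \<rho> = n - 1 \<and> sorted_wrt (<) \<rho> \<and> frobenius_det q u m n D f \<rho> \<noteq> 0 \<longrightarrow>
        (\<rho>, \<kappa>) \<notin> lex less_than)"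

definition frobenius_classical ::
    "nat \<Rightarrow> nat \<Rightarrow> nat \<Rightarrow> nat \<Rightarrow> (nat \<Rightarrow> 'f \<Rightarrow> 'f) \<Rightarrow> (nat \<Rightarrow> 'f::field) \<Rightarrow> bool" where
  "frobenius_classical q u m n D f \<longleftrightarrow>
     (\<exists>\<kappa>. frobenius_order_sequence q u m n D f \<kappa> \<and> (\<forall>i\<le>n - 2. \<kappa> ! i = i))"

end

theory Submission
  imports Defs "HOL-Number_Theory.Residues"
begin

text \<open>Write \<open>k\<close> for \<open>\<kappa>\<^sub>l\<close>, and \<open>D\<^sup>(\<^sup>r\<^sup>)f\<close> for the row vector of the \<open>r\<close>-th Hasse derivatives of
  the coordinate functions.  Let \<open>U\<close> be the span, over the function field, of the two Frobenius rows
  and of \<open>D\<^sup>(\<^sup>i\<^sup>)f\<close> for \<open>i < l\<close>.  Two facts are played against each other.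

  \<^item> Minimality of the order sequence means that nothing new appears between \<open>l\<close> and \<open>k\<close>: for
    \<open>l \<le> r < k\<close> the row \<open>D\<^sup>(\<^sup>r\<^sup>)f\<close> lies in \<open>U\<close>.  Otherwise \<open>r\<close> could be exchanged
    for one of the orders from \<open>k\<close> onwards, giving a lexicographically smaller sequence with nonzero
    determinant (\<open>frobenius_order_exchange\<close>).

  \<^item> Hasse derivatives compose by \<open>D\<^sup>(\<^sup>1\<^sup>) D\<^sup>(\<^sup>r\<^sup>) = (r + 1) D\<^sup>(\<^sup>r\<^sup>+\<^sup>1\<^sup>)\<close>
    (\<open>hasse_first_iterate\<close>).  The axioms give this on the polynomials in \<open>t\<close>, and separability of the
    function field over the subfield generated by \<open>t\<close> carries it to all functions.

  Since \<open>k > l\<close>, the rows \<open>D\<^sup>(\<^sup>l\<^sup>)f\<close> and \<open>D\<^sup>(\<^sup>k\<^sup>-\<^sup>1\<^sup>)f\<close> both lie in \<open>U\<close>.  Differentiate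
  once a relation that expresses the latter by the generators of \<open>U\<close>.  On the left this gives
  \<open>k D\<^sup>(\<^sup>k\<^sup>)f\<close>.  On the right the Frobenius rows consist of \<open>p\<close>-th powers and so behave as
  constants, and the row \<open>D\<^sup>(\<^sup>i\<^sup>)f\<close> contributes multiples of itself and of \<open>D\<^sup>(\<^sup>i\<^sup>+\<^sup>1\<^sup>)f\<close>, where
  \<open>i + 1 \<le> l\<close>; hence the right-hand side is again in \<open>U\<close>.  But \<open>D\<^sup>(\<^sup>k\<^sup>)f\<close> is not in \<open>U\<close>, because
  it is a row of the nonsingular matrix of the order sequence.  So \<open>k\<close> is zero in the function field,
  that is, \<open>p\<close> divides \<open>k\<close>.\<close>

section \<open>Iterating Hasse derivatives\<close>

text \<open>By the chain rule a derivation contributes a term for each coefficient and one for the argument;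
  here the former are absent.\<close>

lemma poly_derivation:
  fixes \<delta> :: "'f::field \<Rightarrow> 'f"
  assumes add: "\<And>g h. \<delta> (g + h) = \<delta> g + \<delta> h"
    and mult: "\<And>g h. \<delta> (g * h) = \<delta> g * h + g * \<delta> h"
    and coeffs: "\<And>i. \<delta> (poly.coeff Q i) = 0"
  shows "\<delta> (poly Q g) = poly (pderiv Q) g * \<delta> g"
  using coeffs
proof (induction Q)
  case 0
  have "\<delta> 0 = 0" using add[of 0 0] by (simp only: add_0_left add_cancel_right_right)
  then show ?case by simp
next
  case (pCons a Q)
  have "\<delta> a = 0" using pCons.prems[of 0] by simp
  moreover have "\<delta> (poly Q g) = poly (pderiv Q) g * \<delta> g"
    using pCons.IH pCons.prems[of "Suc i" for i] by simp
  ultimately show ?case by (simp add: add mult pderiv_pCons algebra_simps)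
qed

text \<open>A derivation that kills the constants and \<open>t\<close> kills the subfield that they generate.  If \<open>Q\<close> is
  a separable polynomial over this subfield with root \<open>g\<close>, then applying the derivation to \<open>Q(g) = 0\<close>
  leaves \<open>Q'(g) \<delta>(g) = 0\<close>, and \<open>Q'(g)\<close> is nonzero.\<close>

lemma derivation_eq_0:
  fixes \<delta> :: "'f::field \<Rightarrow> 'f"
  assumes "field_hom \<iota>" and sep: "separating_variable \<iota> t"
    and add: "\<And>g h. \<delta> (g + h) = \<delta> g + \<delta> h"
    and mult: "\<And>g h. \<delta> (g * h) = \<delta> g * h + g * \<delta> h"
    and const: "\<And>c. \<delta> (\<iota> c) = 0" and t: "\<delta> t = 0"
  shows "\<delta> g = 0"
proof -
  interpret field_hom \<iota> by fact
  have simple: "\<delta> x = 0" if x: "x \<in> simple_extension \<iota> t" for x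
  proof -
    obtain a b where b: "poly (map_poly \<iota> b) t \<noteq> 0"
      and x_eq: "x = poly (map_poly \<iota> a) t / poly (map_poly \<iota> b) t"
      using x unfolding simple_extension_def by blast
    have poly_t: "\<delta> (poly (map_poly \<iota> p) t) = 0" for p
      using poly_derivation[of \<delta> "map_poly \<iota> p" t, OF add mult]
      by (simp add: coeff_map_poly const t)
    have "0 = \<delta> (x * poly (map_poly \<iota> b) t)"
      using b poly_t[of a] by (simp add: x_eq)
    also have "\<dots> = \<delta> x * poly (map_poly \<iota> b) t"
      by (simp add: mult poly_t)
    finally show ?thesis using b by simp
  qed
  obtain Q where Q: "\<And>i. poly.coeff Q i \<in> simple_extension \<iota> t"
    and root: "poly Q g = 0" and cop: "coprime Q (pderiv Q)"
    using sep unfolding separating_variable_def by blast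
  have "poly (pderiv Q) g \<noteq> 0"
  proof
    assume "poly (pderiv Q) g = 0"
    with root have "is_unit [:- g, 1:]"
      using cop by (meson coprime_common_divisor poly_eq_0_iff_dvd)
    then show False by (simp add: is_unit_iff_degree)
  qed
  moreover have "\<delta> 0 = 0" using add[of 0 0] by (simp only: add_0_left add_cancel_right_right)
  ultimately show ?thesis
    using poly_derivation[of \<delta> Q g, OF add mult simple[OF Q]] root by simp
qed

context
  fixes \<iota> :: "'a::field \<Rightarrow> 'f::field" and t :: 'f and D :: "nat \<Rightarrow> 'f \<Rightarrow> 'f"
  assumes hasse: "hasse_derivatives \<iota> t D"
begin

lemma hasse_id: "D 0 g = g"
  and hasse_add: "D r (g + h) = D r g + D r h"
  and hasse_scale: "D r (\<iota> c * g) = \<iota> c * D r g"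
  and hasse_mult: "D r (g * h) = (\<Sum>i\<le>r. D i g * D (r - i) h)"
  and hasse_power: "D r (t ^ j) = of_nat (j choose r) * t ^ (j - r)"
  using hasse unfolding hasse_derivatives_def by blast+

lemma hasse_0: "D r 0 = 0"
  using hasse_add[of r 0 0] by (simp only: add_0_left add_cancel_right_right)

lemma hasse_sum: "D r (\<Sum>i\<in>A. g i) = (\<Sum>i\<in>A. D r (g i))"
  by (induction A rule: infinite_finite_induct) (auto simp: hasse_0 hasse_add)

lemma hasse_1: "r > 0 \<Longrightarrow> D r 1 = 0"
  using hasse_power[of r 0] by (simp add: binomial_eq_0)

lemma hasse_const: "r > 0 \<Longrightarrow> D r (\<iota> c) = 0"
  using hasse_scale[of r c 1] by (simp add: hasse_1)

lemma hasse_first_mult: "D 1 (g * h) = D 1 g * h + g * D 1 h"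
  by (simp add: hasse_mult hasse_id)

lemma hasse_first_power: "D 1 (g ^ k) = of_nat k * g ^ (k - 1) * D 1 g"
proof (induction k)
  case 0
  show ?case using hasse_1[of 1] by simp
next
  case (Suc k)
  have "D 1 (g ^ Suc k) = D 1 g * g ^ k + g * D 1 (g ^ k)"
    by (simp only: power_Suc hasse_first_mult)
  also have "\<dots> = D 1 g * g ^ k + of_nat k * (g * g ^ (k - 1)) * D 1 g"
    by (simp only: Suc) (simp add: algebra_simps)
  also have "of_nat k * (g * g ^ (k - 1)) = of_nat k * g ^ k"
    by (cases k) auto
  finally show ?case by (simp add: algebra_simps)
qed

text \<open>By induction on \<open>r\<close>.  The defect \<open>\<delta> r = D 1 \<circ> D r - (r + 1) D (r + 1)\<close> satisfies
  \<open>\<delta> r (g h) = (\<Sum>i\<le>r. \<delta> i g * D (r - i) h + D i g * \<delta> (r - i) h)\<close>.  As all lower defects vanish, only the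
  terms with \<open>\<delta> r\<close> remain and \<open>\<delta> r\<close> is a derivation.  It kills the constants and \<open>t\<close>, so it is zero.\<close>

lemma hasse_first_iterate:
  assumes "field_hom \<iota>" and "separating_variable \<iota> t"
  shows "D 1 (D r g) = of_nat (Suc r) * D (Suc r) g"
proof (induction r arbitrary: g rule: less_induct)
  case (less r)
  define \<delta> where "\<delta> j x = D 1 (D j x) - of_nat (Suc j) * D (Suc j) x" for j x
  have lower: "\<delta> j x = 0" if "j < r" for j x
    using less[OF that] by (simp add: \<delta>_def)
  have D1D: "D 1 (D j x) = \<delta> j x + of_nat (Suc j) * D (Suc j) x" for j x
    by (simp add: \<delta>_def)
  have "\<delta> r g = 0"
  proof (rule derivation_eq_0[where \<delta> = "\<delta> r", OF assms])
    show "\<delta> r (g + h) = \<delta> r g + \<delta> r h" for g h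
      by (simp add: \<delta>_def hasse_add algebra_simps)
    show "\<delta> r (g * h) = \<delta> r g * h + g * \<delta> r h" for g h
    proof -
      let ?S = "\<lambda>w. \<Sum>i\<le>Suc r. of_nat (w i) * (D i g * D (Suc r - i) h)"
      have "(\<Sum>i\<le>r. \<delta> i g * D (r - i) h) = (\<Sum>i\<in>{r}. \<delta> i g * D (r - i) h)"
        by (rule sum.mono_neutral_right) (auto simp: lower)
      then have left: "(\<Sum>i\<le>r. \<delta> i g * D (r - i) h) = \<delta> r g * h"
        by (simp add: hasse_id)
      have "(\<Sum>i\<le>r. D i g * \<delta> (r - i) h) = (\<Sum>i\<in>{0}. D i g * \<delta> (r - i) h)"
        by (rule sum.mono_neutral_right) (auto simp: lower)
      then have right: "(\<Sum>i\<le>r. D i g * \<delta> (r - i) h) = g * \<delta> r h"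
        by (simp add: hasse_id)
      have shift_left:
        "(\<Sum>i\<le>r. of_nat (Suc i) * (D (Suc i) g * D (r - i) h)) = ?S (\<lambda>i. i)"
        by (subst sum.atMost_Suc_shift) simp
      have shift_right:
        "(\<Sum>i\<le>r. of_nat (Suc (r - i)) * (D i g * D (Suc (r - i)) h)) = ?S (\<lambda>i. Suc r - i)"
        by (simp add: Suc_diff_le del: of_nat_Suc of_nat_diff)
      \<comment> \<open>The weights \<open>i\<close> and \<open>r + 1 - i\<close> of the two shifted sums add up to \<open>r + 1\<close>, which turns them
        into the Leibniz expansion of \<open>(r + 1) D (r + 1) (g h)\<close>.\<close>
      have "D 1 (D r (g * h)) =
          (\<Sum>i\<le>r. D 1 (D i g) * D (r - i) h + D i g * D 1 (D (r - i) h))"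
        by (simp only: hasse_mult[of r] hasse_sum hasse_first_mult)
      also have "\<dots> = (\<Sum>i\<le>r. \<delta> i g * D (r - i) h) + (\<Sum>i\<le>r. D i g * \<delta> (r - i) h) +
          ((\<Sum>i\<le>r. of_nat (Suc i) * (D (Suc i) g * D (r - i) h)) +
           (\<Sum>i\<le>r. of_nat (Suc (r - i)) * (D i g * D (Suc (r - i)) h)))"
        unfolding D1D sum.distrib[symmetric]
        by (rule sum.cong) (simp_all add: algebra_simps)
      also have "\<dots> = \<delta> r g * h + g * \<delta> r h + (?S (\<lambda>i. i) + ?S (\<lambda>i. Suc r - i))"
        unfolding left right shift_left shift_right ..
      also have "?S (\<lambda>i. i) + ?S (\<lambda>i. Suc r - i) = of_nat (Suc r) * D (Suc r) (g * h)"
        unfolding hasse_mult[of "Suc r"] sum_distrib_left sum.distrib[symmetric]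
        by (rule sum.cong) (auto simp: distrib_right[symmetric] of_nat_add[symmetric]
            simp del: of_nat_add of_nat_Suc)
      finally show ?thesis by (simp add: \<delta>_def)
    qed
    show "\<delta> r (\<iota> c) = 0" for c
      by (cases "r = 0") (simp_all add: \<delta>_def hasse_const hasse_0 hasse_id)
    have D_t: "D j t = (if j = 0 then t else if j = 1 then 1 else 0)" for j
      using hasse_power[of j 1] by (cases j) (auto simp: binomial_eq_0)
    show "\<delta> r t = 0"
      using hasse_1[of 1] by (auto simp: \<delta>_def D_t hasse_0)
  qed
  then show ?case by (simp add: \<delta>_def)
qed

end

section \<open>Rows of a nonsingular matrix\<close>

lemma det_nonzero_solve:
  fixes R :: "nat \<Rightarrow> nat \<Rightarrow> 'f::field"
  assumes "det (mat n n (\<lambda>(i, j). R i j)) \<noteq> 0"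
  shows "\<exists>v. \<forall>i<n. (\<Sum>j<n. R i j * v j) = b i"
proof -
  let ?A = "mat n n (\<lambda>(i, j). R i j)"
  obtain B where B: "B \<in> carrier_mat n n" "?A * B = 1\<^sub>m n"
    using det_non_zero_imp_unit[OF _ assms, of n] by (auto simp: Units_def ring_mat_def)
  define v where "v = B *\<^sub>v vec n b"
  have v: "v \<in> carrier_vec n" using B by (simp add: v_def)
  have Av: "?A *\<^sub>v v = vec n b"
    unfolding v_def using B by (subst assoc_mult_mat_vec[symmetric, of _ n n _ n]) auto
  have "(\<Sum>j<n. R i j * vec_index v j) = b i" if "i < n" for i
  proof -
    have "(\<Sum>j<n. R i j * vec_index v j) = vec_index (?A *\<^sub>v v) i"
      using that v by (simp add: scalar_prod_def atLeast0LessThan)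
    also have "\<dots> = b i" using that by (simp add: Av)
    finally show ?thesis .
  qed
  then show ?thesis by (intro exI[of _ "\<lambda>j. vec_index v j"]) blast
qed

lemma det_nonzero_span:
  fixes R :: "nat \<Rightarrow> nat \<Rightarrow> 'f::field"
  assumes "det (mat n n (\<lambda>(i, j). R i j)) \<noteq> 0"
  shows "\<exists>c. \<forall>j<n. w j = (\<Sum>i<n. c i * R i j)"
proof -
  have "mat n n (\<lambda>(i, j). R j i) = transpose_mat (mat n n (\<lambda>(i, j). R i j))"
    by auto
  then have "det (mat n n (\<lambda>(i, j). R j i)) \<noteq> 0"
    using assms by (simp add: det_transpose[of _ n])
  from det_nonzero_solve[OF this, of w] obtain c
    where c: "\<forall>j<n. (\<Sum>i<n. R i j * c i) = w j" by blast
  show ?thesis by (intro exI[of _ c]) (use c in \<open>simp add: mult.commute\<close>)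
qed

lemma det_nonzero_iff_kernel:
  fixes R :: "nat \<Rightarrow> nat \<Rightarrow> 'f::field"
  shows "det (mat n n (\<lambda>(i, j). R i j)) \<noteq> 0 \<longleftrightarrow>
    (\<forall>v. (\<forall>i<n. (\<Sum>j<n. R i j * v j) = 0) \<longrightarrow> (\<forall>j<n. v j = 0))"
    (is "det ?A \<noteq> 0 \<longleftrightarrow> ?K")
proof -
  have A: "?A \<in> carrier_mat n n" by simp
  have prod: "?A *\<^sub>v v = 0\<^sub>v n \<longleftrightarrow> (\<forall>i<n. (\<Sum>j<n. R i j * vec_index v j) = 0)"
    if "v \<in> carrier_vec n" for v
    using that by (auto simp: vec_eq_iff scalar_prod_def atLeast0LessThan)
  have zero: "v = 0\<^sub>v n \<longleftrightarrow> (\<forall>j<n. vec_index v j = 0)" if "v \<in> carrier_vec n" for v :: "'f vec"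
    using that by (auto simp: vec_eq_iff)
  have "det ?A \<noteq> 0 \<longleftrightarrow>
      (\<forall>v\<in>carrier_vec n. (\<forall>i<n. (\<Sum>j<n. R i j * vec_index v j) = 0) \<longrightarrow> (\<forall>j<n. vec_index v j = 0))"
    using det_0_iff_vec_prod_zero[OF A] prod zero by blast
  also have "\<dots> \<longleftrightarrow> ?K"
  proof
    assume *: "\<forall>v\<in>carrier_vec n. (\<forall>i<n. (\<Sum>j<n. R i j * vec_index v j) = 0) \<longrightarrow> (\<forall>j<n. vec_index v j = 0)"
    show ?K
    proof (intro allI impI)
      fix v j assume "\<forall>i<n. (\<Sum>j<n. R i j * v j) = 0" "j < n"
      with *[rule_format, of "vec n v" j] show "v j = 0" by simp
    qed
  qed blast
  finally show ?thesis .
qed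

section \<open>Exchange in the Frobenius order sequence\<close>

definition frobenius_row ::
    "nat \<Rightarrow> nat \<Rightarrow> nat \<Rightarrow> (nat \<Rightarrow> 'f \<Rightarrow> 'f) \<Rightarrow> (nat \<Rightarrow> 'f::field) \<Rightarrow> nat list \<Rightarrow> nat \<Rightarrow> nat \<Rightarrow> 'f" where
  "frobenius_row q u m D f \<rho> i j =
     (if i = 0 then f j ^ (q ^ m) else if i = 1 then f j ^ (q ^ u) else D (\<rho> ! (i - 2)) (f j))"

lemma frobenius_row_simps:
  "frobenius_row q u m D f \<rho> 0 j = f j ^ (q ^ m)"
  "frobenius_row q u m D f \<rho> (Suc 0) j = f j ^ (q ^ u)"
  "frobenius_row q u m D f \<rho> (Suc (Suc k)) j = D (\<rho> ! k) (f j)"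
  by (simp_all add: frobenius_row_def)

lemma frobenius_det_rows:
  "frobenius_det q u m n D f \<rho> =
     det (mat (n + 1) (n + 1) (\<lambda>(i, j). frobenius_row q u m D f \<rho> i j))"
  by (simp add: frobenius_det_def frobenius_row_def)

text \<open>The kernel of the matrix depends only on the set of its rows.  In this form one can pass from one
  list of orders to another that contains the same numbers in a different arrangement without
  following the sign of the determinant.\<close>

lemma frobenius_det_nonzero_iff:
  assumes "n \<ge> 1" and "length \<rho> = n - 1"
  shows "frobenius_det q u m n D f \<rho> \<noteq> 0 \<longleftrightarrow>
    (\<forall>v. (\<Sum>j<n + 1. f j ^ (q ^ m) * v j) = 0 \<longrightarrow> (\<Sum>j<n + 1. f j ^ (q ^ u) * v j) = 0 \<longrightarrow>
       (\<forall>r\<in>set \<rho>. (\<Sum>j<n + 1. D r (f j) * v j) = 0) \<longrightarrow> (\<forall>j<n + 1. v j = 0))"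
proof -
  have n: "n + 1 = Suc (Suc (length \<rho>))" using assms by simp
  have "(\<forall>i<n + 1. (\<Sum>j<n + 1. frobenius_row q u m D f \<rho> i j * v j) = 0) \<longleftrightarrow>
      (\<Sum>j<n + 1. f j ^ (q ^ m) * v j) = 0 \<and> (\<Sum>j<n + 1. f j ^ (q ^ u) * v j) = 0 \<and>
      (\<forall>r\<in>set \<rho>. (\<Sum>j<n + 1. D r (f j) * v j) = 0)" for v
    by (simp only: n All_less_Suc2 frobenius_row_simps all_set_conv_all_nth)
  then show ?thesis
    by (simp only: frobenius_det_rows det_nonzero_iff_kernel imp_conjL)
qed

text \<open>As \<open>r\<close> lies strictly between the entries before position \<open>l\<close> and all later ones, it takes
  position \<open>l\<close> itself, and the entries after it, with \<open>s\<close> left out, move up behind it.\<close>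

lemma strictly_sorted_exchange:
  fixes xs :: "nat list"
  assumes sorted: "sorted_wrt (<) xs" and l: "l < length xs"
    and below: "\<forall>i<l. xs ! i < r" and above: "r < xs ! l" and s: "s \<in> set (drop l xs)"
  shows "\<exists>ys. length ys = length xs \<and> sorted_wrt (<) ys \<and> (ys, xs) \<in> lex less_than \<and>
    set ys = insert r (set xs - {s})"
proof -
  define zs where "zs = removeAll s (drop l xs)"
  have set_xs: "set xs = set (take l xs) \<union> set (drop l xs)"
    by (metis append_take_drop_id set_append)
  have drop: "drop l xs = xs ! l # drop (Suc l) xs"
    using l by (simp add: Cons_nth_drop_Suc)
  have "sorted_wrt (<) (take l xs @ drop l xs)" using sorted by simp
  then have sorted_take: "sorted_wrt (<) (take l xs)" and sorted_drop: "sorted_wrt (<) (drop l xs)"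
    and take_drop: "\<forall>x\<in>set (take l xs). \<forall>y\<in>set (drop l xs). x < y"
    unfolding sorted_wrt_append by blast+
  have take_less: "\<forall>x\<in>set (take l xs). x < r"
    using below l by (auto simp: in_set_conv_nth)
  have less_drop: "\<forall>y\<in>set (drop l xs). r < y"
    using sorted_drop above unfolding drop by auto
  have zs: "set zs = set (drop l xs) - {s}" "sorted_wrt (<) zs"
    using sorted_drop by (auto simp: zs_def removeAll_filter_not_eq intro: sorted_wrt_filter)
  have "distinct (drop l xs)" using sorted_drop by (simp add: strict_sorted_iff)
  then have "length zs = length (drop l xs) - 1"
    using s unfolding zs_def by (simp only: distinct_remove1_removeAll[symmetric] length_remove1 if_True)
  then have len: "length zs = length (drop (Suc l) xs)"
    by simp
  have "(take l xs @ r # zs, take l xs @ drop l xs) \<in> lex less_than"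
    using above len unfolding drop by (intro lex_append_leftI) simp
  moreover have "sorted_wrt (<) (take l xs @ r # zs)"
    using sorted_take take_less less_drop take_drop zs by (auto simp: sorted_wrt_append)
  moreover have "set (take l xs @ r # zs) = insert r (set xs - {s})"
    using take_drop s zs(1) by (auto simp: set_xs)
  moreover have "length (take l xs @ r # zs) = length xs"
    using len l by simp
  ultimately show ?thesis by (intro exI[of _ "take l xs @ r # zs"]) simp
qed

text \<open>The rows for \<open>\<kappa>\<close> form a basis, so the row of order \<open>r\<close> is a combination of them.  If the basis
  row of some order \<open>s \<ge> \<kappa> ! l\<close> occurred in it, then exchanging \<open>s\<close> for \<open>r\<close> would again give a
  basis, and its sequence of orders would precede \<open>\<kappa>\<close>.  Positions are shifted by 2 because the two
  Frobenius rows come first.\<close>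

lemma frobenius_order_exchange:
  assumes "n \<ge> 1" and ord: "frobenius_order_sequence q u m n D f \<kappa>" and l: "l < length \<kappa>"
    and below: "\<forall>i<l. \<kappa> ! i < r" and above: "r < \<kappa> ! l"
  shows "\<exists>c. \<forall>j<n + 1. D r (f j) = (\<Sum>i<l + 2. c i * frobenius_row q u m D f \<kappa> i j)"
proof -
  let ?R = "frobenius_row q u m D f \<kappa>"
  have len: "length \<kappa> = n - 1" and sorted: "sorted_wrt (<) \<kappa>"
    and det: "frobenius_det q u m n D f \<kappa> \<noteq> 0"
    and minimal: "\<And>\<rho>. length \<rho> = n - 1 \<Longrightarrow> sorted_wrt (<) \<rho> \<Longrightarrow>
      frobenius_det q u m n D f \<rho> \<noteq> 0 \<Longrightarrow> (\<rho>, \<kappa>) \<notin> lex less_than"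
    using ord unfolding frobenius_order_sequence_def by auto
  from det_nonzero_span[OF det[unfolded frobenius_det_rows], of "\<lambda>j. D r (f j)"]
  obtain c where c: "\<forall>j<n + 1. D r (f j) = (\<Sum>i<n + 1. c i * ?R i j)" by blast
  have "c k = 0" if k: "l + 2 \<le> k" "k < n + 1" for k
  proof (rule ccontr)
    assume ck: "c k \<noteq> 0"
    define s where "s = \<kappa> ! (k - 2)"
    have dist: "distinct \<kappa>" using sorted by (simp add: strict_sorted_iff)
    have "s \<in> set (drop l \<kappa>)"
      using nth_mem[of "k - 2 - l" "drop l \<kappa>"] k len by (simp add: s_def)
    from strictly_sorted_exchange[OF sorted l below above this]
    obtain \<rho> where len_\<rho>: "length \<rho> = n - 1" and sorted_\<rho>: "sorted_wrt (<) \<rho>"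
      and "(\<rho>, \<kappa>) \<in> lex less_than" and set_\<rho>: "set \<rho> = insert r (set \<kappa> - {s})"
      unfolding len by blast
    have "frobenius_det q u m n D f \<rho> \<noteq> 0"
      unfolding frobenius_det_nonzero_iff[OF \<open>n \<ge> 1\<close> len_\<rho>]
    proof (intro allI impI)
      fix v j
      assume vm: "(\<Sum>j<n + 1. f j ^ (q ^ m) * v j) = 0"
        and vu: "(\<Sum>j<n + 1. f j ^ (q ^ u) * v j) = 0"
        and v\<rho>: "\<forall>r\<in>set \<rho>. (\<Sum>j<n + 1. D r (f j) * v j) = 0"
        and j: "j < n + 1"
      have v\<kappa>: "(\<Sum>j<n + 1. D x (f j) * v j) = 0" if "x \<in> set \<kappa>" "x \<noteq> s" for x
        using v\<rho> that by (simp add: set_\<rho> del: sum.lessThan_Suc)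
      have rows: "(\<Sum>j<n + 1. ?R i j * v j) = 0" if i: "i < n + 1" "i \<noteq> k" for i
      proof -
        consider "i = 0" | "i = Suc 0" | i' where "i = Suc (Suc i')"
          by (metis not0_implies_Suc)
        then show ?thesis
        proof cases
          case 3
          have "\<kappa> ! i' \<noteq> s"
            using i k len 3 dist by (auto simp: s_def nth_eq_iff_index_eq)
          moreover have "\<kappa> ! i' \<in> set \<kappa>" using i len 3 by simp
          ultimately show ?thesis using v\<kappa> 3 by (simp only: frobenius_row_simps)
        qed (use vm vu in \<open>simp_all only: frobenius_row_simps\<close>)
      qed
      \<comment> \<open>All basis rows but the \<open>k\<close>-th annihilate \<open>v\<close>, so pairing the combination for \<open>r\<close> with \<open>v\<close>
        leaves \<open>c k\<close> times the pairing of the \<open>k\<close>-th row.\<close>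
      have "0 = (\<Sum>j<n + 1. D r (f j) * v j)"
        using v\<rho> by (simp add: set_\<rho> del: sum.lessThan_Suc)
      also have "\<dots> = (\<Sum>j<n + 1. \<Sum>i<n + 1. c i * (?R i j * v j))"
        using c by (intro sum.cong) (auto simp: sum_distrib_right mult.assoc simp del: sum.lessThan_Suc)
      also have "\<dots> = (\<Sum>i<n + 1. c i * (\<Sum>j<n + 1. ?R i j * v j))"
        by (subst sum.swap) (simp only: sum_distrib_left)
      also have "\<dots> = (\<Sum>i\<in>{k}. c i * (\<Sum>j<n + 1. ?R i j * v j))"
        using k rows by (intro sum.mono_neutral_right) (auto simp del: sum.lessThan_Suc)
      finally have "(\<Sum>j<n + 1. ?R k j * v j) = 0" using ck by simp
      moreover have "?R k j = D s (f j)" for j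
        using k by (simp add: frobenius_row_def s_def)
      ultimately have "(\<Sum>j<n + 1. D s (f j) * v j) = 0" by (simp only:)
      with v\<kappa> have "\<forall>x\<in>set \<kappa>. (\<Sum>j<n + 1. D x (f j) * v j) = 0" by metis
      then show "v j = 0"
        using det[unfolded frobenius_det_nonzero_iff[OF \<open>n \<ge> 1\<close> len]] vm vu j by blast
    qed
    with minimal[OF len_\<rho> sorted_\<rho>] show False using \<open>(\<rho>, \<kappa>) \<in> lex less_than\<close> by blast
  qed
  then have "(\<Sum>i<n + 1. c i * ?R i j) = (\<Sum>i<l + 2. c i * ?R i j)" for j
    using l len by (intro sum.mono_neutral_right) auto
  with c show ?thesis by auto
qed

theorem theorem3p7:
  fixes C :: "(nat \<Rightarrow> 'a::{field,finite} alg_closure) set"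
    and \<iota> :: "'a \<Rightarrow> 'f::field"
    and \<xi> :: "nat \<Rightarrow> 'f"
    and f :: "nat \<Rightarrow> 'f"
    and \<phi> :: "(nat \<Rightarrow> 'a alg_closure) \<Rightarrow> (nat \<Rightarrow> 'a alg_closure)"
    and t :: 'f
    and D :: "nat \<Rightarrow> 'f \<Rightarrow> 'f"
    and N n u m l :: nat
    and \<kappa> :: "nat list"
  assumes "smooth_projective_curve N C"
    and "is_function_field N C \<iota> \<xi>"
    and "coprime u m" and "1 \<le> u" and "u < m"
    and "n > 2"
    and "is_morphism N C \<iota> \<xi> n f \<phi>"
    and "nondegenerate C n \<phi>"
    and "separating_variable \<iota> t"
    and "hasse_derivatives \<iota> t D"
    and "\<not> frobenius_classical CARD('a) u m n D f"
    and "frobenius_order_sequence CARD('a) u m n D f \<kappa>"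
    and "l \<in> {1..n - 2}"
    and "\<forall>i<l. \<kappa> ! i = i"
    and "\<kappa> ! l > l"
  shows "CHAR('a) dvd \<kappa> ! l"
proof -
  let ?q = "CARD('a)" and ?R = "frobenius_row CARD('a) u m D f \<kappa>"
  let ?k = "\<kappa> ! l"
  interpret field_hom \<iota>
    using assms(2) by (simp add: is_function_field_def)
  note hasse = \<open>hasse_derivatives \<iota> t D\<close>
  note iterate = hasse_first_iterate[OF hasse field_hom_axioms \<open>separating_variable \<iota> t\<close>]
  have \<iota>_of_nat: "of_nat k = (0 :: 'f) \<longleftrightarrow> of_nat k = (0 :: 'a)" for k
  proof -
    have "of_nat k = \<iota> (of_nat k)" by (induction k) (simp_all add: hom_add)
    then show ?thesis by (metis hom_0_iff)
  qed
  have D1_q: "D 1 (g ^ (?q ^ e)) = 0" if "e > 0" for g e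
  proof -
    have "of_nat ?q = (0 :: 'a)"
      using CHAR_dvd_CARD by (simp add: of_nat_eq_0_iff_char_dvd)
    then have "of_nat (?q ^ e) = (0 :: 'f)"
      using that by (simp add: \<iota>_of_nat)
    then show ?thesis by (simp only: hasse_first_power[OF hasse] mult_zero_left)
  qed
  have n: "n \<ge> 1" using assms by simp
  have len: "length \<kappa> = n - 1" and det: "frobenius_det ?q u m n D f \<kappa> \<noteq> 0"
    using assms(12) unfolding frobenius_order_sequence_def by auto
  have l: "l < length \<kappa>" using assms(6,13) len by auto
  note exchange = frobenius_order_exchange[OF n assms(12) l]
  \<comment> \<open>Pairing with the dual basis vector \<open>v\<close> of the row of order \<open>\<kappa> ! l\<close> vanishes on the span of the
    preceding rows, so it separates that row from them.\<close>
  obtain v where v: "\<And>i. i < n + 1 \<Longrightarrow> (\<Sum>j<n + 1. ?R i j * v j) = of_bool (i = l + 2)"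
    using det_nonzero_solve[OF det[unfolded frobenius_det_rows], of "\<lambda>i. of_bool (i = l + 2)"]
    by blast
  have v_span: "(\<Sum>j<n + 1. (\<Sum>i<l + 2. c i * ?R i j) * v j) = 0" for c
  proof -
    have "(\<Sum>j<n + 1. (\<Sum>i<l + 2. c i * ?R i j) * v j) =
        (\<Sum>i<l + 2. c i * (\<Sum>j<n + 1. ?R i j * v j))"
      unfolding sum_distrib_right sum_distrib_left by (subst sum.swap) (simp only: mult.assoc)
    also have "\<dots> = 0"
      using v l len by (intro sum.neutral) (auto simp del: sum.lessThan_Suc)
    finally show ?thesis .
  qed
  have v_m: "(\<Sum>j<n + 1. f j ^ (?q ^ m) * v j) = 0"
    using v[of 0] by (simp add: frobenius_row_simps del: sum.lessThan_Suc)
  have v_u: "(\<Sum>j<n + 1. f j ^ (?q ^ u) * v j) = 0"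
    using v[of 1] n by (simp add: frobenius_row_simps del: sum.lessThan_Suc)
  have v_low: "(\<Sum>j<n + 1. D i (f j) * v j) = 0" if "i \<le> l" for i
  proof (cases "i < l")
    case True
    then show ?thesis
      using v[of "i + 2"] l len assms(14)
      by (simp add: frobenius_row_simps del: sum.lessThan_Suc)
  next
    \<comment> \<open>The remaining order \<open>i = l\<close> is not in \<open>\<kappa>\<close>, but \<open>l < \<kappa> ! l\<close> puts its row in the same span.\<close>
    case False
    then obtain c where "\<forall>j<n + 1. D i (f j) = (\<Sum>i<l + 2. c i * ?R i j)"
      using exchange[of i] assms(14,15) \<open>i \<le> l\<close> by auto
    then show ?thesis using v_span[of c] by (simp del: sum.lessThan_Suc)
  qed
  have v_top: "(\<Sum>j<n + 1. D ?k (f j) * v j) = 1"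
    using v[of "l + 2"] l len by (simp add: frobenius_row_simps del: sum.lessThan_Suc)
  obtain c where c: "\<forall>j<n + 1. D (?k - 1) (f j) = (\<Sum>i<l + 2. c i * ?R i j)"
    using exchange[of "?k - 1"] assms(14,15) by fastforce
  \<comment> \<open>The first derivative of this relation; the Frobenius rows are constants for \<open>D 1\<close>.\<close>
  have diff: "of_nat ?k * D ?k (f j) = D 1 (c 0) * f j ^ (?q ^ m) + D 1 (c 1) * f j ^ (?q ^ u) +
      (\<Sum>i<l. D 1 (c (i + 2)) * D i (f j) + c (i + 2) * (of_nat (Suc i) * D (Suc i) (f j)))"
    if j: "j < n + 1" for j
  proof -
    have "D (?k - 1) (f j) = c 0 * f j ^ (?q ^ m) + c 1 * f j ^ (?q ^ u) +
        (\<Sum>i<l. c (i + 2) * D i (f j))"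
      using c[rule_format, OF j] assms(14)
      by (simp add: sum.lessThan_Suc_shift frobenius_row_simps add.assoc del: sum.lessThan_Suc)
    moreover have "of_nat ?k * D ?k (f j) = D 1 (D (?k - 1) (f j))"
      using iterate[of "?k - 1" "f j"] assms(15) by simp
    ultimately show ?thesis
      using assms(4,5) D1_q[of u] D1_q[of m]
      by (simp only: hasse_add[OF hasse] hasse_sum[OF hasse] hasse_first_mult[OF hasse] iterate) simp
  qed
  have "of_nat ?k = (\<Sum>j<n + 1. of_nat ?k * D ?k (f j) * v j)"
    using v_top by (simp add: mult.assoc sum_distrib_left[symmetric] del: sum.lessThan_Suc)
  also have "\<dots> = (\<Sum>j<n + 1. D 1 (c 0) * (f j ^ (?q ^ m) * v j)
      + D 1 (c 1) * (f j ^ (?q ^ u) * v j)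
      + (\<Sum>i<l. D 1 (c (i + 2)) * (D i (f j) * v j)
          + c (i + 2) * of_nat (Suc i) * (D (Suc i) (f j) * v j)))"
    by (rule sum.cong) (simp_all add: diff sum_distrib_left sum_distrib_right algebra_simps)
  also have "\<dots> = D 1 (c 0) * (\<Sum>j<n + 1. f j ^ (?q ^ m) * v j)
      + D 1 (c 1) * (\<Sum>j<n + 1. f j ^ (?q ^ u) * v j)
      + (\<Sum>i<l. D 1 (c (i + 2)) * (\<Sum>j<n + 1. D i (f j) * v j)
          + c (i + 2) * of_nat (Suc i) * (\<Sum>j<n + 1. D (Suc i) (f j) * v j))"
    unfolding sum_distrib_left sum.distrib
    by (simp only: sum.swap[of _ "{..<l}"])
  also have "\<dots> = 0"
    unfolding v_m v_u using v_low by (simp del: sum.lessThan_Suc)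
  finally show ?thesis
    by (simp only: \<iota>_of_nat of_nat_eq_0_iff_char_dvd)
qed

end
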